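(* Assume that $\delta\rho\ge 0$ and that the solid's behavior is linear, $\mathbb{P}(\mathbb{F})=\kappa\,\mathbb{F}$. Let $(\mathbf{u}_h^n,p_h^n,\mathbf{X}_h^n,\dot{\mathbf{X}}_h^n,\boldsymbol{\lambda}_h^n)$, $n=1,\dots,N$, together with the data at $n=0$, be a solution of the fully discrete BDF2 fluid-structure problem described in the context, and let $\mathbb{F}_h^n=\nabla_s\mathbf{X}_h^n$. Then for every $n=1,\dots,N-1$: $$ \begin{aligned} &\frac{\rho_f}{4\Delta t}\Big[\|\mathbf{u}_h^{n+1}\|_\Omega^2+\|2\mathbf{u}_h^{n+1}-\mathbf{u}_h^n\|_\Omega^2-\|\mathbf{u}_h^n\|_\Omega^2-\|2\mathbf{u}_h^n-\mathbf{u}_h^{n-1}\|_\Omega^2+\|\mathbf{u}_h^{n+1}-2\mathbf{u}_h^n+\mathbf{u}_h^{n-1}\|_\Omega^2\Big]\\ &\quad+\nu\|\nabla_{\rm sym}\mathbf{u}_h^{n+1}\|_\Omega^2\\ &\quad+\frac{\delta\rho}{4\Delta t^2}\Big(\|\dot{\mathbf{X}}_h^{n+1}\|_{\mathcal B}^2+\|2\dot{\mathbf{X}}_h^{n+1}-\dot{\mathbf{X}}_h^n\|_{\mathcal B}^2-\|\dot{\mathbf{X}}_h^n\|_{\mathcal B}^2-\|2\dot{\mathbf{X}}_h^n-\dot{\mathbf{X}}_h^{n-1}\|_{\mathcal B}^2+\|\dot{\mathbf{X}}_h^{n+1}-2\dot{\mathbf{X}}_h^n+\dot{\mathbf{X}}_h^{n-1}\|_{\mathcal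 B}^2\Big)\\ &\quad+\frac{\kappa}{4\Delta t}\Big(\|\mathbb{F}_h^{n+1}\|_{\mathcal B}^2+\|2\mathbb{F}_h^{n+1}-\mathbb{F}_h^n\|_{\mathcal B}^2-\|\mathbb{F}_h^n\|_{\mathcal B}^2-\|2\mathbb{F}_h^n-\mathbb{F}_h^{n-1}\|_{\mathcal B}^2+\|\mathbb{F}_h^{n+1}-2\mathbb{F}_h^n+\mathbb{F}_h^{n-1}\|_{\mathcal B}^2\Big)\le 0 . \end{aligned} $$
   Context: Setting. $d\in\{2,3\}$; $\Omega\subset\mathbb{R}^d$ is a connected bounded open polyhedral Lipschitz domain; $\mathcal B\subset\mathbb{R}^d$ is the (bounded) reference domain of the solid. $(\cdot,\cdot)_D$ and $\|\cdot\|_D$ are the $L^2(D)$ scalar product and norm (for scalar, vector or tensor fields). $\rho_f,\rho_s>0$ are the fluid and solid densities and $\delta\rho=\rho_s-\rho_f$. $\nabla_{\rm sym}\mathbf{u}=\frac12(\nabla\mathbf{u}+(\nabla\mathbf{u})^\top)$; $\nabla_s$ is the gradient with respect to $\mathbf{s}\in\mathcal B$. $\kappa>0$ is a constant. $\mathbb{P}$ is the Piola--Kirchhoff stress tensor, as a function of the deformation gradient $\mathbb{F}$. Forms. $a(\mathbf{u},\mathbf{v})=(\nu\nabla_{\rm sym}\mathbf{u},\nabla_{\rm sym}\mathbf{v})_\Omega$, where $\nu>0$ is the viscosity (value $\nu_f$ in the fluid region and $\nu_s$ in the solid region); $\nu\|\nabla_{\rm sym}\mathbf{w}\|_\Omega^2$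 denotes $a(\mathbf{w},\mathbf{w})=\int_\Omega\nu|\nabla_{\rm sym}\mathbf{w}|^2\,d\mathbf{x}$ (the ordinary product if $\nu$ is constant). $b(\mathbf{u},\mathbf{v},\mathbf{w})=\frac{\rho_f}{2}\big((\mathbf{u}\cdot\nabla\mathbf{v},\mathbf{w})_\Omega-(\mathbf{u}\cdot\nabla\mathbf{w},\mathbf{v})_\Omega\big)$. $\mathbf{c}:\boldsymbol\Lambda\times H^1(\mathcal B)^d\to\mathbb{R}$ is a continuous bilinear form, with $\boldsymbol\Lambda$ a function space, such that $\mathbf{c}(\boldsymbol\mu,\mathbf{z})=0$ for all $\boldsymbol\mu\in\boldsymbol\Lambda$ implies $\mathbf{z}=0$ (e.g. the duality pairing between $\boldsymbol\Lambda=(H^1(\mathcal B)^d)'$ and $H^1(\mathcal B)^d$, or the $H^1(\mathcal B)^d$ scalar product with $\boldsymbol\Lambda=H^1(\mathcal B)^d$). Discrete spaces. $\mathbf{V}_h\subset H^1_0(\Omega)^d$ and $Q_h\subset L^2_0(\Omega)$ (zero-mean $L^2$ functions) are finite element spaces satisfying the inf-sup condition for the Stokes equations; $\mathbf{S}_h\subset H^1(\mathcal B)^d$ is the space of continuous piecewise affine $\mathbb{R}^d$-valued functions on a simplicial mesh of $\mathcal B$; $\boldsymbol\Lambda_h=\mathbf{S}_h$ (viewed in $\boldsymbol\Lambda$). For $\mathbf{v}_h\in\mathbf{V}_h$ and $\mathbf{X}\in\mathbf{S}_h$, $\mathbf{v}_h(\mathbf{X})$ denotes the composition $\mathbf{v}_h\circ\mathbf{X}$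 on $\mathcal B$, understood to be well defined and in $H^1(\mathcal B)^d$ for the discrete deformations $\mathbf{X}_h^n$ occurring below. Time step: $\Delta t=T/N$ with $T>0$. BDF2 problem. Given $\mathbf{u}_h^0=\mathbf{u}_{0h}\in\mathbf{V}_h$, $\mathbf{X}_h^0=\mathbf{X}_{0h}\in\mathbf{S}_h$, $\dot{\mathbf{X}}_h^0\in\mathbf{S}_h$, and first-step values $\mathbf{u}_h^1\in\mathbf{V}_h$, $\mathbf{X}_h^1,\dot{\mathbf{X}}_h^1\in\mathbf{S}_h$ computed by some one-step method, the sequences $\mathbf{u}_h^n\in\mathbf{V}_h$, $p_h^n\in Q_h$, $\mathbf{X}_h^n\in\mathbf{S}_h$, $\dot{\mathbf{X}}_h^n\in\mathbf{S}_h$, $\boldsymbol\lambda_h^n\in\boldsymbol\Lambda_h$ satisfy, for $n=1,\dots,N-1$ (here $\dot{\mathbf{X}}_h^n$ is an independent unknown, not a derivative): 1. for all $\mathbf{v}_h\in\mathbf{V}_h$: $\rho_f\big(\frac{3\mathbf{u}_h^{n+1}-4\mathbf{u}_h^n+\mathbf{u}_h^{n-1}}{2\Delta t},\mathbf{v}_h\big)_\Omega+b(\mathbf{u}_h^{n+1},\mathbf{u}_h^{n+1},\mathbf{v}_h)+a(\mathbf{u}_h^{n+1},\mathbf{v}_h)-(\operatorname{div}\mathbf{v}_h,p_h^{n+1})_\Omega+\mathbf{c}(\boldsymbol\lambda_h^{n+1},\mathbf{v}_h(\mathbf{X}_h^{n+1}))=0$; 2. for all $q_h\in Q_h$: $(\operatorname{div}\mathbf{u}_h^{n+1},q_h)_\Omega=0$;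 3. for all $\mathbf{w}_h\in\mathbf{S}_h$: $(\dot{\mathbf{X}}_h^{n+1},\mathbf{w}_h)_{\mathcal B}=\big(\frac{3\mathbf{X}_h^{n+1}-4\mathbf{X}_h^n+\mathbf{X}_h^{n-1}}{2\Delta t},\mathbf{w}_h\big)_{\mathcal B}$; 4. for all $\mathbf{z}_h\in\mathbf{S}_h$: $\delta\rho\big(\frac{3\dot{\mathbf{X}}_h^{n+1}-4\dot{\mathbf{X}}_h^n+\dot{\mathbf{X}}_h^{n-1}}{2\Delta t},\mathbf{z}_h\big)_{\mathcal B}+(\mathbb{P}(\mathbb{F}_h^{n+1}),\nabla_s\mathbf{z}_h)_{\mathcal B}-\mathbf{c}(\boldsymbol\lambda_h^{n+1},\mathbf{z}_h)=0$, with $\mathbb{F}_h^{n+1}=\nabla_s\mathbf{X}_h^{n+1}$; 5. for all $\boldsymbol\mu_h\in\boldsymbol\Lambda_h$: $\mathbf{c}\big(\boldsymbol\mu_h,\mathbf{u}_h^{n+1}(\mathbf{X}_h^{n+1})-\frac{3\mathbf{X}_h^{n+1}-4\mathbf{X}_h^n+\mathbf{X}_h^{n-1}}{2\Delta t}\big)=0$.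
   Formalization: The solid kinetic term carries the weight δρ/(4Δt) instead of the printed δρ/(4Δt²); with the printed weight the inequality fails in general when Δt ≠ 1 and δρ > 0. *)

theory Defs
  imports "HOL-Analysis.Analysis"
begin

section \<open>Square-integrable fields\<close>

text \<open>
  Elements of the function spaces are represented by total functions on the ambient space; only
  their values on the domain matter, up to null sets for the \<open>L\<^sup>2\<close> and \<open>H\<^sup>1\<close> notions.
  The definitions are polymorphic in the values, so that they cover scalar, vector and tensor
  fields; on matrices the inner product of the library is the Frobenius product.
\<close>

definition L2 :: "'a::euclidean_space set \<Rightarrow> ('a \<Rightarrow> 'b::euclidean_space) set" where
  "L2 D = {f. f \<in> borel_measurable (lebesgue_on D) \<and>
              integrable (lebesgue_on D) (\<lambda>x. (norm (f x))\<^sup>2)}"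

definition l2_inner ::
    "'a::euclidean_space set \<Rightarrow> ('a \<Rightarrow> 'b::euclidean_space) \<Rightarrow> ('a \<Rightarrow> 'b) \<Rightarrow> real" where
  "l2_inner D f g = (LINT x|lebesgue_on D. f x \<bullet> g x)"

definition l2_norm :: "'a::euclidean_space set \<Rightarrow> ('a \<Rightarrow> 'b::euclidean_space) \<Rightarrow> real" where
  "l2_norm D f = sqrt (l2_inner D f f)"

definition L2_zero_mean :: "'a::euclidean_space set \<Rightarrow> ('a \<Rightarrow> real) set" where
  "L2_zero_mean D = {q \<in> L2 D. (LINT x|lebesgue_on D. q x) = 0}"


section \<open>Weak gradients and Sobolev spaces\<close>

definition partial_deriv ::
    "'n::finite \<Rightarrow> (real^'n \<Rightarrow> 'b::real_normed_vector) \<Rightarrow> real^'n \<Rightarrow> 'b" where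
  "partial_deriv j f x = frechet_derivative f (at x) (axis j 1)"

primrec C_k :: "nat \<Rightarrow> (real^'n::finite \<Rightarrow> 'b::real_normed_vector) \<Rightarrow> bool" where
  "C_k 0 f \<longleftrightarrow> continuous_on UNIV f"
| "C_k (Suc k) f \<longleftrightarrow> (\<forall>x. f differentiable (at x)) \<and> (\<forall>j. C_k k (partial_deriv j f))"

definition test_function ::
    "(real^'n::finite) set \<Rightarrow> (real^'n \<Rightarrow> 'b::real_normed_vector) \<Rightarrow> bool" where
  "test_function D \<phi> \<longleftrightarrow> (\<forall>k. C_k k \<phi>) \<and>
     compact (closure {x. \<phi> x \<noteq> 0}) \<and> closure {x. \<phi> x \<noteq> 0} \<subseteq> D"

text \<open>The entry \<open>G x $ i $ j\<close> is the weak \<open>j\<close>-th partial derivative of the \<open>i\<close>-th component.\<close>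

definition is_weak_gradient ::
    "(real^'n::finite) set \<Rightarrow> (real^'n \<Rightarrow> real^'m::finite) \<Rightarrow> (real^'n \<Rightarrow> real^'n^'m) \<Rightarrow> bool" where
  "is_weak_gradient D u G \<longleftrightarrow> (\<forall>\<phi> i j. test_function D \<phi> \<longrightarrow>
     (LINT x|lebesgue_on D. u x $ i * partial_deriv j \<phi> x) =
     - (LINT x|lebesgue_on D. G x $ i $ j * \<phi> x))"

definition H1 :: "(real^'n::finite) set \<Rightarrow> (real^'n \<Rightarrow> real^'m::finite) set" where
  "H1 D = {u \<in> L2 D. \<exists>G \<in> L2 D. is_weak_gradient D u G}"

text \<open>A representative of the weak gradient, which is unique up to null sets for open \<open>D\<close>.\<close>

definition grad ::
    "(real^'n::finite) set \<Rightarrow> (real^'n \<Rightarrow> real^'m::finite) \<Rightarrow> real^'n \<Rightarrow> real^'n^'m" where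
  "grad D u = (SOME G. G \<in> L2 D \<and> is_weak_gradient D u G)"

definition sym_grad ::
    "(real^'n::finite) set \<Rightarrow> (real^'n \<Rightarrow> real^'n) \<Rightarrow> real^'n \<Rightarrow> real^'n^'n" where
  "sym_grad D u x = (1/2) *\<^sub>R (grad D u x + transpose (grad D u x))"

definition divergence ::
    "(real^'n::finite) set \<Rightarrow> (real^'n \<Rightarrow> real^'n) \<Rightarrow> real^'n \<Rightarrow> real" where
  "divergence D u x = trace (grad D u x)"

definition h1_norm :: "(real^'n::finite) set \<Rightarrow> (real^'n \<Rightarrow> real^'m::finite) \<Rightarrow> real" where
  "h1_norm D u = sqrt ((l2_norm D u)\<^sup>2 + (l2_norm D (grad D u))\<^sup>2)"

definition H1_0 :: "(real^'n::finite) set \<Rightarrow> (real^'n \<Rightarrow> real^'m::finite) set" where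
  "H1_0 D = {u \<in> H1 D. \<exists>\<phi>. (\<forall>k. test_function D (\<phi> k)) \<and>
               (\<lambda>k::nat. h1_norm D (\<lambda>x. u x - \<phi> k x)) \<longlonglongrightarrow> 0}"


section \<open>Domains and meshes\<close>

definition bounded_domain :: "'a::euclidean_space set \<Rightarrow> bool" where
  "bounded_domain D \<longleftrightarrow> open D \<and> connected D \<and> bounded D \<and> D \<noteq> {}"

text \<open>
  Near each boundary point the domain is the strict epigraph of a Lipschitz function in a rotated
  coordinate system: \<open>e\<close> is the vertical direction, \<open>y \<bullet> e\<close> the height of \<open>y\<close>, and
  \<open>y - (y \<bullet> e) *\<^sub>R e\<close> its horizontal part.
\<close>

definition lipschitz_boundary :: "'a::euclidean_space set \<Rightarrow> bool" where
  "lipschitz_boundary D \<longleftrightarrow>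
     (\<forall>x \<in> frontier D. \<exists>r e C. \<exists>\<gamma> :: 'a \<Rightarrow> real. 0 < r \<and> norm e = 1 \<and>
        C-lipschitz_on {y. y \<bullet> e = 0} \<gamma> \<and>
        D \<inter> ball x r = {y \<in> ball x r. \<gamma> (y - (y \<bullet> e) *\<^sub>R e) < y \<bullet> e})"

definition polyhedral :: "'a::euclidean_space set \<Rightarrow> bool" where
  "polyhedral D \<longleftrightarrow> (\<exists>P. finite P \<and> (\<forall>K \<in> P. polytope K) \<and> \<Union>P = closure D)"

definition polytopal_mesh :: "'a::euclidean_space set \<Rightarrow> 'a set set \<Rightarrow> bool" where
  "polytopal_mesh D M \<longleftrightarrow> finite M \<and> (\<forall>K \<in> M. polytope K \<and> interior K \<noteq> {}) \<and>
     (\<forall>K \<in> M. \<forall>L \<in> M. K \<noteq> L \<longrightarrow> interior K \<inter> interior L = {}) \<and> \<Union>M = closure D"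

definition simplicial_mesh :: "'a::euclidean_space set \<Rightarrow> 'a set set \<Rightarrow> bool" where
  "simplicial_mesh D M \<longleftrightarrow>
     triangulation M \<and> (\<forall>K \<in> M. int DIM('a) simplex K) \<and> \<Union>M = closure D"


section \<open>Discrete spaces\<close>

definition finite_dim_space :: "('a \<Rightarrow> 'b::real_vector) set \<Rightarrow> bool" where
  "finite_dim_space W \<longleftrightarrow> (\<exists>A. finite A \<and> W = {f. \<exists>c. f = (\<lambda>x. \<Sum>\<phi>\<in>A. c \<phi> *\<^sub>R \<phi> x)})"

definition finite_element_space ::
    "'a::euclidean_space set \<Rightarrow> ('a \<Rightarrow> 'b::euclidean_space) set \<Rightarrow> bool" where
  "finite_element_space D W \<longleftrightarrow> finite_dim_space W \<and>
     (\<exists>M. polytopal_mesh D M \<and>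
        (\<forall>f \<in> W. \<forall>K \<in> M. \<exists>p. polynomial_function p \<and> (\<forall>x \<in> interior K. f x = p x)))"

text \<open>
  The quotient is 0 for functions of norm 0, because division by 0 yields 0; this does not affect
  the supremum, as \<open>V\<close> is closed under negation.
\<close>

definition stokes_inf_sup ::
    "(real^'n::finite) set \<Rightarrow> (real^'n \<Rightarrow> real^'n) set \<Rightarrow> (real^'n \<Rightarrow> real) set \<Rightarrow> bool" where
  "stokes_inf_sup D V Q \<longleftrightarrow> (\<exists>\<beta>>0. \<forall>q \<in> Q.
     \<beta> * l2_norm D q \<le> (SUP v \<in> V. l2_inner D (divergence D v) q / h1_norm D v))"

definition P1_space ::
    "(real^'n::finite) set \<Rightarrow> (real^'n) set set \<Rightarrow> (real^'n \<Rightarrow> real^'n) set" where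
  "P1_space D M = {X \<in> H1 D. continuous_on (closure D) X \<and>
     (\<forall>K \<in> M. \<exists>A b. \<forall>s \<in> K. X s = A *v s + b)}"


section \<open>Forms\<close>

definition a_form ::
    "(real^'n::finite) set \<Rightarrow> (real^'n \<Rightarrow> real) \<Rightarrow> (real^'n \<Rightarrow> real^'n) \<Rightarrow> (real^'n \<Rightarrow> real^'n) \<Rightarrow> real"
  where
  "a_form D \<nu> u v = l2_inner D (\<lambda>x. \<nu> x *\<^sub>R sym_grad D u x) (sym_grad D v)"

text \<open>With the convention above for \<open>grad\<close>, the field \<open>u \<cdot> \<nabla>v\<close> is \<open>grad D v x *v u x\<close>.\<close>

definition b_form ::
    "(real^'n::finite) set \<Rightarrow> real \<Rightarrow> (real^'n \<Rightarrow> real^'n) \<Rightarrow> (real^'n \<Rightarrow> real^'n) \<Rightarrow>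
     (real^'n \<Rightarrow> real^'n) \<Rightarrow> real" where
  "b_form D \<rho> u v w = \<rho> / 2 * (l2_inner D (\<lambda>x. grad D v x *v u x) w
                             - l2_inner D (\<lambda>x. grad D w x *v u x) v)"

text \<open>
  The space \<open>\<Lambda>\<close> is a linear subspace of some normed space. The bound makes the form depend only
  on the \<open>H\<^sup>1\<close> class of its second argument.
\<close>

definition coupling_form ::
    "'l::real_normed_vector set \<Rightarrow> (real^'n::finite) set \<Rightarrow> ('l \<Rightarrow> (real^'n \<Rightarrow> real^'n) \<Rightarrow> real) \<Rightarrow> bool"
  where
  "coupling_form \<Lambda> B c \<longleftrightarrow> subspace \<Lambda> \<and>
     (\<forall>\<mu> \<in> \<Lambda>. \<forall>\<mu>' \<in> \<Lambda>. \<forall>z \<in> H1 B. c (\<mu> + \<mu>') z = c \<mu> z + c \<mu>' z) \<and>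
     (\<forall>\<mu> \<in> \<Lambda>. \<forall>z \<in> H1 B. \<forall>r. c (r *\<^sub>R \<mu>) z = r * c \<mu> z) \<and>
     (\<forall>\<mu> \<in> \<Lambda>. \<forall>z \<in> H1 B. \<forall>z' \<in> H1 B. c \<mu> (\<lambda>s. z s + z' s) = c \<mu> z + c \<mu> z') \<and>
     (\<forall>\<mu> \<in> \<Lambda>. \<forall>z \<in> H1 B. \<forall>r. c \<mu> (\<lambda>s. r *\<^sub>R z s) = r * c \<mu> z) \<and>
     (\<exists>C. \<forall>\<mu> \<in> \<Lambda>. \<forall>z \<in> H1 B. \<bar>c \<mu> z\<bar> \<le> C * norm \<mu> * h1_norm B z) \<and>
     (\<forall>z \<in> H1 B. (\<forall>\<mu> \<in> \<Lambda>. c \<mu> z = 0) \<longrightarrow> (AE s in lebesgue_on B. z s = 0))"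

text \<open>
  The identification of the discrete space \<open>S\<close> with a subspace of \<open>\<Lambda>\<close> (for instance the inclusion,
  or the map sending a function to the functional it induces by a scalar product). Members of \<open>S\<close>
  that agree on \<open>B\<close> are the same element of the discrete space.
\<close>

definition multiplier_embedding ::
    "(real^'n::finite) set \<Rightarrow> (real^'n \<Rightarrow> real^'n) set \<Rightarrow> 'l::real_normed_vector set \<Rightarrow>
     ((real^'n \<Rightarrow> real^'n) \<Rightarrow> 'l) \<Rightarrow> bool" where
  "multiplier_embedding B S \<Lambda> \<iota> \<longleftrightarrow> \<iota> ` S \<subseteq> \<Lambda> \<and>
     (\<forall>w \<in> S. \<forall>z \<in> S. \<iota> (\<lambda>s. w s + z s) = \<iota> w + \<iota> z) \<and>
     (\<forall>w \<in> S. \<forall>r. \<iota> (\<lambda>s. r *\<^sub>R w s) = r *\<^sub>R \<iota> w) \<and>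
     (\<forall>w \<in> S. \<iota> w = 0 \<longleftrightarrow> (\<forall>s \<in> B. w s = 0))"


section \<open>The BDF2 scheme\<close>

definition bdf2 :: "real \<Rightarrow> (nat \<Rightarrow> 'a \<Rightarrow> 'b::real_vector) \<Rightarrow> nat \<Rightarrow> 'a \<Rightarrow> 'b" where
  "bdf2 dt f n x = (1 / (2 * dt)) *\<^sub>R (3 *\<^sub>R f (n+1) x - 4 *\<^sub>R f n x + f (n-1) x)"

text \<open>
  With \<open>f = f\<^sup>n\<^sup>+\<^sup>1\<close>, \<open>g = f\<^sup>n\<close>, \<open>h = f\<^sup>n\<^sup>-\<^sup>1\<close>, this is four times \<open>dt\<close> times the \<open>L\<^sup>2\<close> product of the BDF2
  difference quotient with \<open>f\<^sup>n\<^sup>+\<^sup>1\<close>. Every kinetic and elastic term of the energy estimate therefore carries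
  the weight \<open>1 / (4 * dt)\<close>. For the solid kinetic term the source prints \<open>1 / (4 * dt\<^sup>2)\<close>; with
  that weight the estimate fails in general whenever \<open>dt \<noteq> 1\<close>.
\<close>

definition bdf2_bracket ::
    "'a::euclidean_space set \<Rightarrow> ('a \<Rightarrow> 'b::euclidean_space) \<Rightarrow> ('a \<Rightarrow> 'b) \<Rightarrow> ('a \<Rightarrow> 'b) \<Rightarrow> real" where
  "bdf2_bracket D f g h =
     (l2_norm D f)\<^sup>2 + (l2_norm D (\<lambda>x. 2 *\<^sub>R f x - g x))\<^sup>2
     - (l2_norm D g)\<^sup>2 - (l2_norm D (\<lambda>x. 2 *\<^sub>R g x - h x))\<^sup>2
     + (l2_norm D (\<lambda>x. f x - 2 *\<^sub>R g x + h x))\<^sup>2"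

end

theory Submission
  imports Defs
begin

text \<open>
  Test the fluid equation with \<open>u\<^sup>n\<^sup>+\<^sup>1\<close>, the solid equation with the difference quotient \<open>bdf2 dt X n\<close>,
  and the equation for \<open>X'\<close> with \<open>bdf2 dt X' n\<close>: the convective and pressure terms vanish, the two
  coupling terms cancel by the kinematic constraint, and each inertial or elastic term has the form
  \<open>(bdf2 dt f n, f\<^sup>n\<^sup>+\<^sup>1)\<close>, which a polarization identity turns into a bracket. The estimate is in fact
  an equality. As \<open>grad\<close> is a choice of weak gradient, its linearity up to null sets, needed for the
  elastic term, rests on the uniqueness of weak gradients, that is, on the fundamental lemma of the
  calculus of variations. The latter is obtained from bump functions that converge to the indicators
  of boxes.
\<close>

section \<open>The space of square-integrable fields\<close>

lemma L2_measurable: "f \<in> L2 D \<Longrightarrow> f \<in> borel_measurable (lebesgue_on D)"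
  by (simp add: L2_def)

lemma L2_integrable_inner:
  assumes "f \<in> L2 D" "g \<in> L2 D"
  shows "integrable (lebesgue_on D) (\<lambda>x. f x \<bullet> g x)"
proof (rule Bochner_Integration.integrable_bound)
  show "integrable (lebesgue_on D) (\<lambda>x. (norm (f x))\<^sup>2 + (norm (g x))\<^sup>2)"
    using assms by (auto simp: L2_def)
  show "(\<lambda>x. f x \<bullet> g x) \<in> borel_measurable (lebesgue_on D)"
    using assms[THEN L2_measurable] by measurable
  have "\<bar>a \<bullet> b\<bar> \<le> (norm a)\<^sup>2 + (norm b)\<^sup>2" for a b :: 'b
  proof -
    have "\<bar>a \<bullet> b\<bar> \<le> norm a * norm b"
      by (rule Cauchy_Schwarz_ineq2)
    also have "\<dots> \<le> (norm a)\<^sup>2 + (norm b)\<^sup>2"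
      using sum_squares_bound[of "norm a" "norm b"] mult_nonneg_nonneg[of "norm a" "norm b"]
      unfolding mult.assoc by (smt (verit) norm_ge_zero)
    finally show ?thesis .
  qed
  then show "AE x in lebesgue_on D. norm (f x \<bullet> g x) \<le> norm ((norm (f x))\<^sup>2 + (norm (g x))\<^sup>2)"
    by simp
qed

lemma L2_add:
  assumes "f \<in> L2 D" "g \<in> L2 D"
  shows "(\<lambda>x. f x + g x) \<in> L2 D"
proof -
  have "(\<lambda>x. (norm (f x + g x))\<^sup>2) = (\<lambda>x. (norm (f x))\<^sup>2 + 2 * (f x \<bullet> g x) + (norm (g x))\<^sup>2)"
    by (simp add: power2_norm_eq_inner inner_simps inner_commute algebra_simps)
  then show ?thesis
    using assms L2_integrable_inner[OF assms] by (auto simp: L2_def)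
qed

text \<open>Scalar multiples and vector components are both instances; matrix entries come from
  taking components twice.\<close>

lemma L2_bounded_linear:
  assumes "f \<in> L2 D" "bounded_linear h"
  shows "(\<lambda>x. h (f x)) \<in> L2 D"
proof -
  obtain K where K: "\<And>y. norm (h y) \<le> norm y * K"
    using bounded_linear.bounded[OF assms(2)] by blast
  have "h \<in> borel_measurable borel"
    using assms(2) by (intro borel_measurable_continuous_onI linear_continuous_on)
  then have meas: "(\<lambda>x. h (f x)) \<in> borel_measurable (lebesgue_on D)"
    using L2_measurable[OF assms(1)] by measurable
  have "integrable (lebesgue_on D) (\<lambda>x. (norm (h (f x)))\<^sup>2)"
  proof (rule Bochner_Integration.integrable_bound)
    show "integrable (lebesgue_on D) (\<lambda>x. K\<^sup>2 * (norm (f x))\<^sup>2)"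
      using assms(1) by (auto simp: L2_def)
    show "(\<lambda>x. (norm (h (f x)))\<^sup>2) \<in> borel_measurable (lebesgue_on D)"
      using meas by measurable
    have "(norm (h y))\<^sup>2 \<le> K\<^sup>2 * (norm y)\<^sup>2" for y
      using power_mono[OF K norm_ge_zero, of y 2] by (simp add: power_mult_distrib mult.commute)
    then show "AE x in lebesgue_on D. norm ((norm (h (f x)))\<^sup>2) \<le> norm (K\<^sup>2 * (norm (f x))\<^sup>2)"
      by simp
  qed
  with meas show ?thesis by (simp add: L2_def)
qed

lemma L2_scaleR: "f \<in> L2 D \<Longrightarrow> (\<lambda>x. r *\<^sub>R f x) \<in> L2 D"
  by (rule L2_bounded_linear[OF _ bounded_linear_scaleR_right])

lemma L2_diff: "f \<in> L2 D \<Longrightarrow> g \<in> L2 D \<Longrightarrow> (\<lambda>x. f x - g x) \<in> L2 D"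
  using L2_add[of f D "\<lambda>x. - 1 *\<^sub>R g x"] L2_scaleR[of g D "-1"] by simp

lemma L2_component: "f \<in> L2 D \<Longrightarrow> (\<lambda>x. f x $ i) \<in> L2 D"
  for f :: "'a::euclidean_space \<Rightarrow> 'b::euclidean_space^'m::finite"
  by (rule L2_bounded_linear[OF _ bounded_linear_vec_nth])

text \<open>Continuity on the whole space makes \<open>f\<close> bounded on the compact closure of
  \<open>D\<close>, and a bounded measurable function is square integrable on a set of finite
  measure.\<close>

lemma continuous_imp_L2:
  fixes f :: "'a::euclidean_space \<Rightarrow> 'b::euclidean_space"
  assumes "open D" "bounded D" "continuous_on UNIV f"
  shows "f \<in> L2 D"
proof -
  have D: "D \<in> sets lebesgue"
    using assms(1) by (simp add: borel_open)
  have meas: "f \<in> borel_measurable (lebesgue_on D)"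
    by (rule continuous_imp_measurable_on_sets_lebesgue)
      (use assms(3) D continuous_on_subset in auto)
  have "compact (closure D)"
    using assms(2) by simp
  then have "bounded (f ` closure D)"
    using assms(3) by (meson compact_continuous_image compact_imp_bounded continuous_on_subset
        subset_UNIV)
  then obtain C where C: "\<And>x. x \<in> D \<Longrightarrow> norm (f x) \<le> C"
    unfolding bounded_iff using closure_subset by blast
  have "finite_measure (lebesgue_on D)"
    using assms(1,2) D
    by (intro finite_measure_lebesgue_on) (simp add: bounded_set_imp_lmeasurable)
  then interpret finite_measure "lebesgue_on D" .
  have "integrable (lebesgue_on D) (\<lambda>x. (norm (f x))\<^sup>2)"
  proof (rule integrable_const_bound[where B="C\<^sup>2"])
    show "AE x in lebesgue_on D. norm ((norm (f x))\<^sup>2) \<le> C\<^sup>2"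
      by (rule AE_I2) (use D C in \<open>auto simp: space_restrict_space intro!: power_mono\<close>)
  qed (use meas in measurable)
  with meas show ?thesis by (simp add: L2_def)
qed

section \<open>The inner product and the polarization identity of BDF2\<close>

lemma l2_inner_commute: "l2_inner D f g = l2_inner D g f"
  by (simp add: l2_inner_def inner_commute)

lemma l2_inner_scaleR_left: "l2_inner D (\<lambda>x. r *\<^sub>R f x) g = r * l2_inner D f g"
  by (simp add: l2_inner_def)

lemma l2_norm_power2: "(l2_norm D f)\<^sup>2 = l2_inner D f f"
  by (simp add: l2_norm_def l2_inner_def integral_nonneg)

lemma L2_bdf2:
  assumes "f (n+1) \<in> L2 D" "f n \<in> L2 D" "f (n-1) \<in> L2 D"
  shows "bdf2 dt f n \<in> L2 D"
  unfolding bdf2_def[abs_def] using assms by (intro L2_add L2_diff L2_scaleR)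

text \<open>Pointwise, with \<open>F\<close>, \<open>G\<close>, \<open>H\<close> the levels
  \<open>n+1\<close>, \<open>n\<close>, \<open>n-1\<close>, the five signed squares of the bracket
  add up to twice the product of \<open>3 F - 4 G + H\<close> with \<open>F\<close>, and
  \<open>4 * dt\<close> times \<open>1 / (2 * dt)\<close> is that factor 2.\<close>

lemma bdf2_bracket_eq:
  assumes f: "f (n+1) \<in> L2 D" "f n \<in> L2 D" "f (n-1) \<in> L2 D" and "dt \<noteq> 0"
  shows "bdf2_bracket D (f (n+1)) (f n) (f (n-1)) / (4 * dt) = l2_inner D (bdf2 dt f n) (f (n+1))"
proof -
  define F G H where "F = f (n+1)" and "G = f n" and "H = f (n-1)"
  note FGH = f[folded F_def G_def H_def]
  let ?I = "\<lambda>p. LINT x|lebesgue_on D. p x"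
  have *: "integrable (lebesgue_on D) (\<lambda>x. p x \<bullet> p x)" if "p \<in> L2 D" for p :: "'a \<Rightarrow> 'b"
    using that by (rule L2_integrable_inner[OF that])
  \<comment> \<open>The integral is additive only over integrable summands, so this is settled
    before the five integrals are merged into one.\<close>
  note int = *[OF FGH(1)] *[OF FGH(2)] *[OF FGH(3)]
    *[OF L2_diff[OF L2_scaleR[OF FGH(1), of 2] FGH(2)]]
    *[OF L2_diff[OF L2_scaleR[OF FGH(2), of 2] FGH(3)]]
    *[OF L2_add[OF L2_diff[OF FGH(1) L2_scaleR[OF FGH(2), of 2]] FGH(3)]]
  have "bdf2_bracket D F G H = ?I (\<lambda>x. F x \<bullet> F x + (2 *\<^sub>R F x - G x) \<bullet> (2 *\<^sub>R F x - G x)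
      - G x \<bullet> G x - (2 *\<^sub>R G x - H x) \<bullet> (2 *\<^sub>R G x - H x)
      + (F x - 2 *\<^sub>R G x + H x) \<bullet> (F x - 2 *\<^sub>R G x + H x))"
    unfolding bdf2_bracket_def l2_norm_power2 l2_inner_def using int by simp
  also have "\<dots> = ?I (\<lambda>x. (4 * dt) * (bdf2 dt f n x \<bullet> F x))"
    by (rule Bochner_Integration.integral_cong)
      (use \<open>dt \<noteq> 0\<close> in \<open>simp_all add: bdf2_def F_def G_def H_def inner_simps inner_commute
         field_simps\<close>)
  finally show ?thesis
    using \<open>dt \<noteq> 0\<close> by (simp add: l2_inner_def F_def G_def H_def)
qed

section \<open>Smooth bump functions\<close>

lemma partial_deriv_eq: "(f has_derivative f') (at x) \<Longrightarrow> partial_deriv j f x = f' (axis j 1)"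
  by (metis frechet_derivative_at partial_deriv_def)

text \<open>Smoothness proofs can thus work with an explicit derivative \<open>f'\<close> in place
  of the \<open>frechet_derivative\<close> built into the definition.\<close>

lemma C_k_SucI:
  assumes "\<And>x. (f has_derivative f' x) (at x)" "\<And>j. C_k k (\<lambda>x. f' x (axis j 1))"
  shows "C_k (Suc k) f"
  using assms partial_deriv_eq[OF assms(1)]
  by (auto simp: differentiable_def) (metis ext)

text \<open>The product rule leaves one factor undifferentiated, which must then enter the induction
  one order lower. At order zero, differentiability gives continuity.\<close>

lemma C_k_SucD: "C_k (Suc k) f \<Longrightarrow> C_k k f"
proof (induction k arbitrary: f)
  case 0
  then show ?case
    by (auto intro!: continuous_at_imp_continuous_on differentiable_imp_continuous_within)
next
  case (Suc k)
  then show ?case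
    unfolding C_k.simps(2)[of "Suc k"] C_k.simps(2)[of k f] by blast
qed

lemma C_k_has_derivative:
  "C_k (Suc k) f \<Longrightarrow> (f has_derivative frechet_derivative f (at x)) (at x)"
  by (simp add: frechet_derivative_works[symmetric])

lemma C_k_const: "C_k k (\<lambda>x. r)"
proof (induction k arbitrary: r)
  case (Suc k)
  show ?case
    by (rule C_k_SucI[OF has_derivative_const]) (rule Suc.IH)
qed simp

lemma C_k_add:
  assumes "C_k k f" "C_k k g"
  shows "C_k k (\<lambda>x. f x + g x)"
  using assms
proof (induction k arbitrary: f g)
  case 0
  then show ?case by (simp add: continuous_on_add)
next
  case (Suc k)
  show ?case
    by (rule C_k_SucI[OF has_derivative_add[OF Suc.prems[THEN C_k_has_derivative]]])
      (use Suc in \<open>auto simp: partial_deriv_def[abs_def]\<close>)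
qed

lemma C_k_mult:
  fixes f g :: "real^'n::finite \<Rightarrow> real"
  assumes "C_k k f" "C_k k g"
  shows "C_k k (\<lambda>x. f x * g x)"
  using assms
proof (induction k arbitrary: f g)
  case 0
  then show ?case by (simp add: continuous_on_mult)
next
  case (Suc k)
  show ?case
    by (rule C_k_SucI[OF has_derivative_mult[OF Suc.prems[THEN C_k_has_derivative]]])
      (use Suc.prems[THEN C_k_SucD] Suc.prems Suc.IH in
        \<open>auto simp: partial_deriv_def[abs_def] intro!: C_k_add\<close>)
qed

lemma C_k_prod:
  fixes f :: "'i \<Rightarrow> real^'n::finite \<Rightarrow> real"
  assumes "\<And>i. i \<in> I \<Longrightarrow> C_k k (f i)"
  shows "C_k k (\<lambda>x. \<Prod>i\<in>I. f i x)"
  using assms by (induction I rule: infinite_finite_induct) (auto intro: C_k_const C_k_mult)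

text \<open>
  The polynomial factor makes the family closed under differentiation, so that smoothness follows
  by induction.
\<close>

definition flat :: "real poly \<Rightarrow> real \<Rightarrow> real" where
  "flat p t = (if t > 0 then poly p (1 / t) * exp (- (1 / t)) else 0)"

text \<open>The exponential beats each monomial of \<open>p\<close>. With \<open>x = 1 / t\<close>
  this controls \<open>flat p\<close> to the right of the origin.\<close>

lemma poly_times_exp_tendsto_0: "((\<lambda>x::real. poly p x * exp (- x)) \<longlongrightarrow> 0) at_top"
proof -
  have "((\<lambda>x. \<Sum>i\<le>degree p. coeff p i * (x ^ i / exp x)) \<longlongrightarrow> (\<Sum>i\<le>degree p. coeff p i * 0)) at_top"
    by (intro tendsto_intros tendsto_power_div_exp_0)
  then show ?thesis
    by (simp add: poly_altdef exp_minus sum_divide_distrib divide_inverse sum_distrib_right mult.assoc)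
qed

text \<open>With \<open>y = 1 / t\<close>, the function \<open>p(y) exp(-y)\<close> has
  \<open>y\<close>-derivative \<open>(p' - p)(y) exp(-y)\<close>, and \<open>dy/dt = - y^2\<close>;
  this produces the polynomial \<open>y^2 (p - p')\<close>.\<close>

lemma flat_has_derivative:
  "(flat p has_real_derivative flat (monom 1 2 * (p - pderiv p)) t) (at t)"
proof -
  consider "t > 0" | "t < 0" | "t = 0" by linarith
  then show ?thesis
  proof cases
    case 1
    have "((\<lambda>t. poly p (1 / t) * exp (- (1 / t))) has_real_derivative
        flat (monom 1 2 * (p - pderiv p)) t) (at t)"
      using 1 by (auto intro!: derivative_eq_intros
          simp: flat_def poly_monom power2_eq_square field_simps)
    then show ?thesis
      by (rule has_field_derivative_transform_within_open[where S="{0<..}"])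
        (use 1 in \<open>auto simp: flat_def\<close>)
  next
    case 2
    have "((\<lambda>t. 0) has_real_derivative flat (monom 1 2 * (p - pderiv p)) t) (at t)"
      using 2 by (simp add: flat_def)
    then show ?thesis
      by (rule has_field_derivative_transform_within_open[where S="{..<0}"])
        (use 2 in \<open>auto simp: flat_def\<close>)
  next
    case 3
    \<comment> \<open>\<open>pCons 0 p\<close> is \<open>y * p(y)\<close>: its extra factor is the
      \<open>1 / h\<close> of the difference quotient, as \<open>flat p 0 = 0\<close>.\<close>
    have "((\<lambda>h. poly (pCons 0 p) (inverse h) * exp (- inverse h)) \<longlongrightarrow> 0) (at_right 0)"
      by (rule filterlim_compose[OF poly_times_exp_tendsto_0 filterlim_inverse_at_top_right])
    then have "((\<lambda>h. (flat p h - flat p 0) / h) \<longlongrightarrow> 0) (at_right 0)"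
      by (rule Lim_transform_eventually)
        (auto simp: flat_def eventually_at_filter field_simps)
    moreover have "((\<lambda>h. (flat p h - flat p 0) / h) \<longlongrightarrow> 0) (at_left 0)"
      by (rule Lim_transform_eventually[OF tendsto_const])
        (auto simp: flat_def eventually_at_filter)
    ultimately have "((\<lambda>h. (flat p h - flat p 0) / h) \<longlongrightarrow> 0) (at 0)"
      by (simp add: filterlim_split_at)
    then show ?thesis
      using 3 by (simp add: has_field_derivative_iff flat_def)
  qed
qed

text \<open>The \<open>j\<close>-th partial derivative has the same shape with another polynomial
  and with the prefactor multiplied by \<open>m * axis j 1 $ i\<close>; letting \<open>r\<close> and
  \<open>p\<close> vary therefore closes the induction.\<close>

lemma C_k_flat: "C_k k (\<lambda>x::real^'n::finite. r * flat p (m * x $ i + b))"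
proof (induction k arbitrary: r p)
  case 0
  have "continuous_on UNIV (flat p)"
    by (meson DERIV_isCont continuous_at_imp_continuous_on flat_has_derivative)
  then have "continuous_on UNIV (\<lambda>x::real^'n. flat p (m * x $ i + b))"
    by (rule continuous_on_compose2) (auto intro!: continuous_intros)
  then show ?case
    by (auto intro!: continuous_intros)
next
  case (Suc k)
  let ?q = "monom 1 2 * (p - pderiv p)"
  have "((\<lambda>x::real^'n. r * flat p (m * x $ i + b)) has_derivative
      (\<lambda>h. (r * m * h $ i) * flat ?q (m * x $ i + b))) (at x)" for x :: "real^'n"
  proof -
    have "((\<lambda>x::real^'n. m * x $ i + b) has_derivative (\<lambda>h. m * h $ i)) (at x)"
      by (auto intro!: derivative_eq_intros bounded_linear.has_derivative[OF bounded_linear_vec_nth])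
    from has_derivative_compose[OF this
        flat_has_derivative[of p "m * x $ i + b", unfolded has_field_derivative_def]]
    have "((\<lambda>x::real^'n. flat p (m * x $ i + b)) has_derivative
      (\<lambda>h. flat ?q (m * x $ i + b) * (m * h $ i))) (at x)" .
    from has_derivative_mult_right[OF this, of r] show ?thesis
      by (simp add: ac_simps)
  qed
  then show ?case
    by (rule C_k_SucI) (rule Suc.IH)
qed

text \<open>There is one factor for each face of the box, and \<open>flat 1\<close> is
  \<open>exp (- (1 / t))\<close> cut off at zero. Growing \<open>k\<close> steepens the transition;
  since \<open>Suc k\<close> is never zero, the nonzero set is the same box for all
  \<open>k\<close>.\<close>

definition bump :: "real^'n::finite \<Rightarrow> real^'n \<Rightarrow> nat \<Rightarrow> real^'n \<Rightarrow> real" where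
  "bump a b k x = (\<Prod>i\<in>UNIV. flat 1 (real (Suc k) * (x $ i - a $ i)) *
                             flat 1 (real (Suc k) * (b $ i - x $ i)))"

lemma flat_1_bounds: "0 \<le> flat 1 t" "flat 1 t \<le> 1"
  by (auto simp: flat_def)

lemma flat_1_eq_0_iff: "flat 1 t = 0 \<longleftrightarrow> t \<le> 0"
  by (auto simp: flat_def)

lemma C_k_bump: "C_k l (bump a b k)"
proof -
  have "C_k l (\<lambda>x. flat 1 (real (Suc k) * (x $ i - a $ i)))"
    "C_k l (\<lambda>x. flat 1 (real (Suc k) * (b $ i - x $ i)))" for i
    using C_k_flat[of l 1 1 "real (Suc k)" i "- real (Suc k) * a $ i"]
      C_k_flat[of l 1 1 "- real (Suc k)" i "real (Suc k) * b $ i"]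
    by (simp_all add: algebra_simps)
  then show ?thesis
    unfolding bump_def[abs_def] by (intro C_k_prod C_k_mult)
qed

lemma bump_bound: "\<bar>bump a b k x\<bar> \<le> 1"
  unfolding bump_def abs_prod
  by (rule prod_le_1) (auto simp: abs_mult flat_1_bounds intro!: mult_le_one)

lemma support_bump: "{x. bump a b k x \<noteq> 0} = box a b"
  by (auto simp: bump_def flat_1_eq_0_iff mem_box_cart mult_le_0_iff not_le)

text \<open>The nonzero set is the open box, whose closure lies in \<open>cbox a b\<close> even if
  the box is degenerate.\<close>

lemma test_function_bump:
  assumes "cbox a b \<subseteq> D"
  shows "test_function D (bump a b k)"
  using assms closure_minimal[OF box_subset_cbox closed_cbox, of a b]
  by (auto simp: test_function_def C_k_bump support_bump)

text \<open>A factor tends to 1 where its argument is positive and is 0 elsewhere, faces included,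
  so the limit is exactly the indicator of the open box.\<close>

lemma bump_tendsto: "(\<lambda>k. bump a b k x) \<longlonglongrightarrow> indicator (box a b) x"
proof -
  have *: "(\<lambda>k. flat 1 (real (Suc k) * s)) \<longlonglongrightarrow> (if s > 0 then 1 else 0)" for s
  proof (cases "s > 0")
    case True
    have "(\<lambda>k. exp (- (inverse (real (Suc k)) / s))) \<longlonglongrightarrow> exp (- (0 / s))"
      using True by (intro tendsto_intros LIMSEQ_inverse_real_of_nat) auto
    with True show ?thesis
      by (simp add: flat_def field_simps zero_less_mult_iff del: of_nat_Suc)
  next
    case False
    then show ?thesis
      by (simp add: flat_def zero_less_mult_iff)
  qed
  have "(\<lambda>k. bump a b k x) \<longlonglongrightarrow> (\<Prod>i\<in>UNIV. (if x $ i - a $ i > 0 then 1 else 0) *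
      (if b $ i - x $ i > 0 then 1 else 0))"
    unfolding bump_def by (intro tendsto_prod tendsto_mult *)
  also have "(\<Prod>i\<in>UNIV. (if x $ i - a $ i > 0 then 1 else 0::real) *
      (if b $ i - x $ i > 0 then 1 else 0)) = indicator (box a b) x"
    by (cases "x \<in> box a b") (auto simp: mem_box_cart)
  finally show ?thesis .
qed

section \<open>Weak gradients\<close>

text \<open>Almost everywhere \<open>g\<close> is the limit of its averages over shrinking cubes,
  and near a point of the open set \<open>D\<close> these cubes lie in \<open>D\<close>, where the
  averages are zero.\<close>

lemma vanishing_on_boxes_imp_AE_0:
  fixes g :: "'a::euclidean_space \<Rightarrow> real"
  assumes D: "open D" and g: "integrable (lebesgue_on D) g"
    and 0: "\<And>a b. cbox a b \<subseteq> D \<Longrightarrow> (LINT x|lebesgue_on D. g x * indicator (box a b) x) = 0"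
  shows "AE x in lebesgue_on D. g x = 0"
proof -
  have D': "D \<in> sets lebesgue"
    using D by (simp add: borel_open)
  have box: "box a b \<in> sets lebesgue" for a b :: 'a
    by (simp add: lmeasurable_box fmeasurableD)
  \<comment> \<open>Extension by zero moves the problem to the whole space, where the
    differentiation theorem applies.\<close>
  define f where "f = (\<lambda>x. if x \<in> D then g x else 0)"
  have "integrable lebesgue f"
    unfolding f_def using g by (simp add: Lebesgue_Measure.integrable_restrict_UNIV[OF D'])
  then have f: "f integrable_on UNIV"
    by (rule integrable_on_lebesgue)
  \<comment> \<open>The hypothesis concerns Lebesgue integrals over open boxes, the differentiation
    theorem gauge integrals over closed ones; the faces are negligible.\<close>
  have box0: "integral (cbox a b) f = 0" if "cbox a b \<subseteq> D" for a b
  proof -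
    have "integral (cbox a b) f = integral (box a b) f"
      by (simp add: integral_open_interval)
    also have "\<dots> = (LINT x|lebesgue_on (box a b). f x)"
    proof (rule lebesgue_integral_eq_integral[symmetric])
      show "integrable (lebesgue_on (box a b)) f"
        using integrable_mult_indicator[OF box \<open>integrable lebesgue f\<close>] box
        by (simp add: integrable_restrict_space)
    qed (rule box)
    also have "\<dots> = (LINT x|lebesgue. (if x \<in> box a b then f x else 0))"
      by (rule Lebesgue_Measure.integral_restrict_UNIV[OF box, symmetric])
    also have "\<dots> = (LINT x|lebesgue. (if x \<in> D then g x * indicator (box a b) x else 0))"
      by (rule Bochner_Integration.integral_cong) (simp_all add: f_def)
    also have "\<dots> = (LINT x|lebesgue_on D. g x * indicator (box a b) x)"
      by (rule Lebesgue_Measure.integral_restrict_UNIV[OF D'])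
    finally show ?thesis
      using 0[OF that] by simp
  qed
  \<comment> \<open>Lebesgue differentiation along cubes with lower corner \<open>x\<close>\<close>
  obtain N where N: "negligible N" and
    lim: "\<And>x e. \<lbrakk>x \<notin> N; 0 < e\<rbrakk> \<Longrightarrow> \<exists>d>0. \<forall>h. 0 < h \<and> h < d \<longrightarrow>
      norm (integral (cbox x (x + h *\<^sub>R One)) f /\<^sub>R h ^ DIM('a) - f x) < e"
    by (rule integrable_ccontinuous_explicit[OF integrable_on_subcbox[OF f subset_UNIV]])
      (rule that)
  have "f x = 0" if x: "x \<in> D" "x \<notin> N" for x
  proof (rule ccontr)
    assume "f x \<noteq> 0"
    then have "0 < \<bar>f x\<bar>" by simp
    from lim[OF x(2) this] obtain d where d: "d > 0" "\<forall>h. 0 < h \<and> h < d \<longrightarrow>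
        norm (integral (cbox x (x + h *\<^sub>R One)) f /\<^sub>R h ^ DIM('a) - f x) < \<bar>f x\<bar>"
      by (elim exE conjE)
    obtain e where e: "e > 0" "cball x e \<subseteq> D"
      using D x(1) open_contains_cball by blast
    \<comment> \<open>Halving \<open>d\<close> gives the strict bound \<open>h < d\<close>; dividing
      \<open>e\<close> by the dimension keeps the l1 distance from the corner \<open>x\<close> at
      most \<open>e\<close>.\<close>
    define h where "h = min (d / 2) (e / DIM('a))"
    have h: "0 < h" "h < d" "h * DIM('a) \<le> e"
      using d(1) e(1) by (auto simp: h_def min_def field_simps)
    have "cbox x (x + h *\<^sub>R One) \<subseteq> cball x e"
    proof
      fix y assume y: "y \<in> cbox x (x + h *\<^sub>R One)"
      have "norm (y - x) \<le> (\<Sum>b\<in>Basis. \<bar>(y - x) \<bullet> b\<bar>)"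
        by (rule norm_le_l1)
      also have "\<dots> \<le> (\<Sum>b\<in>(Basis::'a set). h)"
        using y by (intro sum_mono) (auto simp: mem_box inner_simps)
      also have "\<dots> \<le> e"
        using h(3) by (simp add: mult.commute)
      finally show "y \<in> cball x e"
        by (simp add: dist_norm norm_minus_commute)
    qed
    with e(2) have "integral (cbox x (x + h *\<^sub>R One)) f = 0"
      by (intro box0) blast
    with d(2) h(1,2) show False by fastforce
  qed
  moreover have "AE x in lebesgue. x \<notin> N"
    using N by (simp add: AE_not_in negligible_iff_null_sets)
  ultimately show ?thesis
    using D' by (subst AE_restrict_space_iff) (auto simp: f_def elim!: eventually_mono)
qed

text \<open>The bumps are bounded by 1 and converge to box indicators, so dominated convergence with
  majorant \<open>\<bar>g x\<bar>\<close> carries the vanishing from test functions over to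
  boxes.\<close>

lemma fundamental_lemma_calculus_of_variations:
  fixes g :: "real^'n::finite \<Rightarrow> real"
  assumes D: "open D" and g: "integrable (lebesgue_on D) g"
    and 0: "\<And>\<phi>. test_function D \<phi> \<Longrightarrow> (LINT x|lebesgue_on D. g x * \<phi> x) = 0"
  shows "AE x in lebesgue_on D. g x = 0"
proof (rule vanishing_on_boxes_imp_AE_0[OF D g])
  fix a b :: "real^'n"
  assume ab: "cbox a b \<subseteq> D"
  have D': "D \<in> sets lebesgue"
    using D by (simp add: borel_open)
  have meas: "bump a b k \<in> borel_measurable (lebesgue_on D)" for k
    by (rule continuous_imp_measurable_on_sets_lebesgue)
      (use C_k_bump[of 0 a b k] D' continuous_on_subset in auto)
  have "(\<lambda>k. LINT x|lebesgue_on D. g x * bump a b k x) \<longlonglongrightarrow>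
      (LINT x|lebesgue_on D. g x * indicator (box a b) x)"
  proof (rule integral_dominated_convergence[where w="\<lambda>x. \<bar>g x\<bar>"])
    have "indicat_real (box a b) \<in> borel_measurable lebesgue"
      by (intro borel_measurable_indicator) (simp add: lmeasurable_box fmeasurableD)
    then have "indicat_real (box a b) \<in> borel_measurable (lebesgue_on D)"
      by (rule measurable_restrict_space1)
    then show "(\<lambda>x. g x * indicator (box a b) x) \<in> borel_measurable (lebesgue_on D)"
      using g by simp
    show "(\<lambda>x. g x * bump a b k x) \<in> borel_measurable (lebesgue_on D)" for k
      using g meas by measurable
    show "integrable (lebesgue_on D) (\<lambda>x. \<bar>g x\<bar>)"
      using g by simp
    show "AE x in lebesgue_on D. (\<lambda>k. g x * bump a b k x) \<longlonglongrightarrow> g x * indicator (box a b) x"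
      by (intro AE_I2 tendsto_mult tendsto_const bump_tendsto)
    show "AE x in lebesgue_on D. norm (g x * bump a b k x) \<le> \<bar>g x\<bar>" for k
      by (intro AE_I2) (simp add: abs_mult mult_left_le[OF bump_bound abs_ge_zero])
  qed
  moreover have "(LINT x|lebesgue_on D. g x * bump a b k x) = 0" for k
    by (rule 0[OF test_function_bump[OF ab]])
  ultimately show "(LINT x|lebesgue_on D. g x * indicator (box a b) x) = 0"
    by (simp add: LIMSEQ_const_iff)
qed

section \<open>Uniqueness and linearity of weak gradients\<close>

lemma test_function_L2:
  fixes \<phi> :: "real^'n::finite \<Rightarrow> real"
  assumes "open D" "bounded D" "test_function D \<phi>"
  shows "\<phi> \<in> L2 D" "partial_deriv j \<phi> \<in> L2 D"
proof -
  have "C_k 0 \<phi>" "C_k (Suc 0) \<phi>"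
    using assms(3) unfolding test_function_def by blast+
  then show "\<phi> \<in> L2 D" "partial_deriv j \<phi> \<in> L2 D"
    using assms(1,2) by (auto intro: continuous_imp_L2)
qed

lemma L2_integrable_mult:
  "f \<in> L2 D \<Longrightarrow> g \<in> L2 D \<Longrightarrow> integrable (lebesgue_on D) (\<lambda>x. f x * g x)"
  for f g :: "'a::euclidean_space \<Rightarrow> real"
  using L2_integrable_inner[of f D g] by simp

lemma L2_imp_integrable:
  fixes f :: "'a::euclidean_space \<Rightarrow> real"
  assumes "open D" "bounded D" "f \<in> L2 D"
  shows "integrable (lebesgue_on D) f"
  using L2_integrable_mult[OF assms(3) continuous_imp_L2[OF assms(1,2) continuous_on_const, of 1]]
  by simp

text \<open>Test functions and their partial derivatives are square integrable on \<open>D\<close>,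
  so all products with \<open>u\<close>, \<open>v\<close>, \<open>G\<close>, \<open>H\<close> are
  integrable and the integrals may be split.\<close>

lemma is_weak_gradient_lincomb:
  fixes u v :: "real^'n::finite \<Rightarrow> real^'m::finite"
  assumes D: "open D" "bounded D"
    and L2: "u \<in> L2 D" "v \<in> L2 D" "G \<in> L2 D" "H \<in> L2 D"
    and u: "is_weak_gradient D u G" and v: "is_weak_gradient D v H"
  shows "is_weak_gradient D (\<lambda>x. r *\<^sub>R u x + s *\<^sub>R v x) (\<lambda>x. r *\<^sub>R G x + s *\<^sub>R H x)"
  unfolding is_weak_gradient_def
proof (intro allI impI)
  fix \<phi> :: "real^'n \<Rightarrow> real" and i j
  assume \<phi>: "test_function D \<phi>"
  note \<phi>_L2 = test_function_L2[OF D \<phi>]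
  note int = L2_integrable_mult[OF L2_component[OF L2(1)] \<phi>_L2(2)]
    L2_integrable_mult[OF L2_component[OF L2(2)] \<phi>_L2(2)]
    L2_integrable_mult[OF L2_component[OF L2_component[OF L2(3)]] \<phi>_L2(1)]
    L2_integrable_mult[OF L2_component[OF L2_component[OF L2(4)]] \<phi>_L2(1)]
  show "(LINT x|lebesgue_on D. (r *\<^sub>R u x + s *\<^sub>R v x) $ i * partial_deriv j \<phi> x) =
      - (LINT x|lebesgue_on D. (r *\<^sub>R G x + s *\<^sub>R H x) $ i $ j * \<phi> x)"
    using u v \<phi> int by (simp add: is_weak_gradient_def distrib_right mult.assoc)
qed

text \<open>Each entry of the difference integrates to zero against every test function, and the
  null sets of the finitely many entries can be united.\<close>

lemma weak_gradient_unique: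
  fixes u :: "real^'n::finite \<Rightarrow> real^'m::finite"
  assumes D: "open D" "bounded D" and L2: "G \<in> L2 D" "H \<in> L2 D"
    and G: "is_weak_gradient D u G" and H: "is_weak_gradient D u H"
  shows "AE x in lebesgue_on D. G x = H x"
proof -
  have "AE x in lebesgue_on D. (G x - H x) $ i $ j = 0" for i j
  proof (rule fundamental_lemma_calculus_of_variations[OF D(1)])
    show "integrable (lebesgue_on D) (\<lambda>x. (G x - H x) $ i $ j)"
      by (intro L2_imp_integrable[OF D] L2_component L2_diff L2)
    fix \<phi> :: "real^'n \<Rightarrow> real"
    assume \<phi>: "test_function D \<phi>"
    note int = L2_integrable_mult[OF L2_component[OF L2_component[OF L2(1)]] test_function_L2(1)[OF D \<phi>]]
      L2_integrable_mult[OF L2_component[OF L2_component[OF L2(2)]] test_function_L2(1)[OF D \<phi>]]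
    have "(LINT x|lebesgue_on D. G x $ i $ j * \<phi> x) = (LINT x|lebesgue_on D. H x $ i $ j * \<phi> x)"
      using G[unfolded is_weak_gradient_def, rule_format, OF \<phi>, of i j]
        H[unfolded is_weak_gradient_def, rule_format, OF \<phi>, of i j] by simp
    then show "(LINT x|lebesgue_on D. (G x - H x) $ i $ j * \<phi> x) = 0"
      using int by (simp add: left_diff_distrib)
  qed
  then have "AE x in lebesgue_on D. \<forall>i j. (G x - H x) $ i $ j = 0"
    by (intro eventually_all_finite)
  then show ?thesis
    by (rule eventually_mono) (simp add: vec_eq_iff)
qed

lemma grad_H1:
  assumes "u \<in> H1 D"
  shows "grad D u \<in> L2 D" "is_weak_gradient D u (grad D u)"
  using someI_ex[of "\<lambda>G. G \<in> L2 D \<and> is_weak_gradient D u G"] assms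
  unfolding grad_def H1_def by blast+

lemma H1_imp_L2: "u \<in> H1 D \<Longrightarrow> u \<in> L2 D"
  by (simp add: H1_def)

lemma H1_lincomb:
  assumes D: "open D" "bounded D" and "u \<in> H1 D" "v \<in> H1 D"
  shows "(\<lambda>x. r *\<^sub>R u x + s *\<^sub>R v x) \<in> H1 D"
proof -
  note uv = assms(3,4)
  have "is_weak_gradient D (\<lambda>x. r *\<^sub>R u x + s *\<^sub>R v x) (\<lambda>x. r *\<^sub>R grad D u x + s *\<^sub>R grad D v x)"
    by (intro is_weak_gradient_lincomb D grad_H1 H1_imp_L2 uv)
  moreover have "(\<lambda>x. r *\<^sub>R grad D u x + s *\<^sub>R grad D v x) \<in> L2 D"
    "(\<lambda>x. r *\<^sub>R u x + s *\<^sub>R v x) \<in> L2 D"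
    by (intro L2_add L2_scaleR grad_H1 H1_imp_L2 uv)+
  ultimately show ?thesis
    unfolding H1_def by blast
qed

text \<open>The representatives chosen by \<open>grad\<close> for different functions are unrelated,
  so equality is expected only up to null sets. It holds because both sides are weak gradients of
  the same function.\<close>

lemma grad_lincomb:
  assumes D: "open D" "bounded D" and "u \<in> H1 D" "v \<in> H1 D"
  shows "AE x in lebesgue_on D.
    grad D (\<lambda>x. r *\<^sub>R u x + s *\<^sub>R v x) x = r *\<^sub>R grad D u x + s *\<^sub>R grad D v x"
proof (rule weak_gradient_unique[OF D])
  note uv = assms(3,4)
  show "grad D (\<lambda>x. r *\<^sub>R u x + s *\<^sub>R v x) \<in> L2 D"
    "is_weak_gradient D (\<lambda>x. r *\<^sub>R u x + s *\<^sub>R v x) (grad D (\<lambda>x. r *\<^sub>R u x + s *\<^sub>R v x))"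
    by (intro grad_H1 H1_lincomb D uv)+
  show "(\<lambda>x. r *\<^sub>R grad D u x + s *\<^sub>R grad D v x) \<in> L2 D"
    by (intro L2_add L2_scaleR grad_H1 uv)
  show "is_weak_gradient D (\<lambda>x. r *\<^sub>R u x + s *\<^sub>R v x) (\<lambda>x. r *\<^sub>R grad D u x + s *\<^sub>R grad D v x)"
    by (intro is_weak_gradient_lincomb D grad_H1 H1_imp_L2 uv)
qed

section \<open>The energy estimate\<close>

text \<open>Nesting the three-term quotient lets the results on two-term combinations be applied
  twice.\<close>

lemma bdf2_lincomb:
  "bdf2 dt f n = (\<lambda>x. (1 / (2 * dt)) *\<^sub>R (3 *\<^sub>R f (n+1) x + (- 4) *\<^sub>R f n x)
    + (1 / (2 * dt)) *\<^sub>R f (n-1) x)"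
  by (simp add: bdf2_def fun_eq_iff scaleR_add_right)

lemma grad_bdf2:
  assumes D: "open D" "bounded D" and X: "X (n+1) \<in> H1 D" "X n \<in> H1 D" "X (n-1) \<in> H1 D"
  shows "AE x in lebesgue_on D. grad D (bdf2 dt X n) x = bdf2 dt (\<lambda>n. grad D (X n)) n x"
proof -
  show ?thesis
    using grad_lincomb[OF D H1_lincomb[OF D X(1,2)] X(3), of "1 / (2 * dt)" 3 "- 4" "1 / (2 * dt)"]
      grad_lincomb[OF D X(1,2), of 3 "- 4"]
    unfolding bdf2_lincomb by eventually_elim simp
qed

lemma P1_space_lincomb:
  assumes D: "open D" "bounded D" and "X \<in> P1_space D M" "Y \<in> P1_space D M"
  shows "(\<lambda>x. r *\<^sub>R X x + t *\<^sub>R Y x) \<in> P1_space D M"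
proof -
  have "\<exists>A b. \<forall>s\<in>K. r *\<^sub>R X s + t *\<^sub>R Y s = A *v s + b" if "K \<in> M" for K
  proof -
    obtain A b A' b' where "\<forall>s\<in>K. X s = A *v s + b" "\<forall>s\<in>K. Y s = A' *v s + b'"
      using assms(3,4) \<open>K \<in> M\<close> unfolding P1_space_def by blast
    then have "\<forall>s\<in>K. r *\<^sub>R X s + t *\<^sub>R Y s = (r *\<^sub>R A + t *\<^sub>R A') *v s + (r *\<^sub>R b + t *\<^sub>R b')"
      by (simp add: algebra_simps scaleR_matrix_vector_assoc)
    then show ?thesis by blast
  qed
  moreover have "continuous_on (closure D) (\<lambda>x. r *\<^sub>R X x + t *\<^sub>R Y x)"
    using assms(3,4) by (auto simp: P1_space_def intro!: continuous_intros)
  ultimately show ?thesis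
    using H1_lincomb[OF D, of X Y] assms(3,4) by (auto simp: P1_space_def)
qed

text \<open>This makes the difference quotients of \<open>X\<close> and \<open>X'\<close> admissible
  test functions in \<open>Sh\<close>.\<close>

lemma P1_space_bdf2:
  assumes "open D" "bounded D" "X (n+1) \<in> P1_space D M" "X n \<in> P1_space D M" "X (n-1) \<in> P1_space D M"
  shows "bdf2 dt X n \<in> P1_space D M"
  unfolding bdf2_lincomb by (intro P1_space_lincomb assms)

theorem proposition3p2:
  fixes \<Omega> B :: "(real^'n::finite) set"
    and \<Omega>s :: "nat \<Rightarrow> (real^'n) set"
    and \<rho>f \<rho>s \<nu>f \<nu>s \<kappa> T dt :: real
    and \<nu> :: "nat \<Rightarrow> real^'n \<Rightarrow> real"
    and P :: "real^'n^'n \<Rightarrow> real^'n^'n"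
    and Vh Sh :: "(real^'n \<Rightarrow> real^'n) set"
    and Qh :: "(real^'n \<Rightarrow> real) set"
    and M :: "(real^'n) set set"
    and \<Lambda> \<Lambda>h :: "'l::real_normed_vector set"
    and c :: "'l \<Rightarrow> (real^'n \<Rightarrow> real^'n) \<Rightarrow> real"
    and \<iota> :: "(real^'n \<Rightarrow> real^'n) \<Rightarrow> 'l"
    and N :: nat
    and u X X' :: "nat \<Rightarrow> real^'n \<Rightarrow> real^'n"
    and p :: "nat \<Rightarrow> real^'n \<Rightarrow> real"
    and lam :: "nat \<Rightarrow> 'l"
    and F :: "nat \<Rightarrow> real^'n \<Rightarrow> real^'n^'n"
  assumes dim: "CARD('n) \<in> {2, 3}"
    and fluid_domain: "bounded_domain \<Omega>" "polyhedral \<Omega>" "lipschitz_boundary \<Omega>"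
    and solid_domain: "bounded_domain B"
    and densities: "\<rho>f > 0" "\<rho>s > 0" "\<rho>s - \<rho>f \<ge> 0"
    and viscosity: "\<nu>f > 0" "\<nu>s > 0"
      "\<And>n. \<Omega>s n \<in> sets lebesgue \<and> \<Omega>s n \<subseteq> \<Omega>"
      "\<And>n x. \<nu> n x = (if x \<in> \<Omega>s n then \<nu>s else \<nu>f)"
    and linear_solid: "\<kappa> > 0" "\<And>A. P A = \<kappa> *\<^sub>R A"
    and fluid_spaces: "finite_element_space \<Omega> Vh" "Vh \<subseteq> H1_0 \<Omega>"
      "\<And>v. v \<in> Vh \<Longrightarrow> continuous_on (closure \<Omega>) v"
      "finite_element_space \<Omega> Qh" "Qh \<subseteq> L2_zero_mean \<Omega>"
      "stokes_inf_sup \<Omega> Vh Qh"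
    and solid_space: "simplicial_mesh B M" "Sh = P1_space B M"
    and multipliers: "coupling_form \<Lambda> B c" "multiplier_embedding B Sh \<Lambda> \<iota>" "\<Lambda>h = \<iota> ` Sh"
    and time: "T > 0" "N > 0" "dt = T / real N"
    and spaces: "\<And>n. n \<le> N \<Longrightarrow> u n \<in> Vh" "\<And>n. n \<le> N \<Longrightarrow> X n \<in> Sh" "\<And>n. n \<le> N \<Longrightarrow> X' n \<in> Sh"
      "\<And>n. n \<in> {2..N} \<Longrightarrow> p n \<in> Qh" "\<And>n. n \<in> {2..N} \<Longrightarrow> lam n \<in> \<Lambda>h"
    and composition: "\<And>n. n \<in> {2..N} \<Longrightarrow> X n ` B \<subseteq> closure \<Omega>"
      "\<And>n v. n \<in> {2..N} \<Longrightarrow> v \<in> Vh \<Longrightarrow> (\<lambda>s. v (X n s)) \<in> H1 B"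
    and F: "\<And>n. F n = grad B (X n)"
    and eq1: "\<And>n v. n \<in> {1..N-1} \<Longrightarrow> v \<in> Vh \<Longrightarrow>
      \<rho>f * l2_inner \<Omega> (bdf2 dt u n) v + b_form \<Omega> \<rho>f (u (n+1)) (u (n+1)) v
      + a_form \<Omega> (\<nu> (n+1)) (u (n+1)) v - l2_inner \<Omega> (divergence \<Omega> v) (p (n+1))
      + c (lam (n+1)) (\<lambda>s. v (X (n+1) s)) = 0"
    and eq2: "\<And>n q. n \<in> {1..N-1} \<Longrightarrow> q \<in> Qh \<Longrightarrow>
      l2_inner \<Omega> (divergence \<Omega> (u (n+1))) q = 0"
    and eq3: "\<And>n w. n \<in> {1..N-1} \<Longrightarrow> w \<in> Sh \<Longrightarrow>
      l2_inner B (X' (n+1)) w = l2_inner B (bdf2 dt X n) w"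
    and eq4: "\<And>n z. n \<in> {1..N-1} \<Longrightarrow> z \<in> Sh \<Longrightarrow>
      (\<rho>s - \<rho>f) * l2_inner B (bdf2 dt X' n) z
      + l2_inner B (\<lambda>s. P (F (n+1) s)) (grad B z) - c (lam (n+1)) z = 0"
    and eq5: "\<And>n \<mu>. n \<in> {1..N-1} \<Longrightarrow> \<mu> \<in> \<Lambda>h \<Longrightarrow>
      c \<mu> (\<lambda>s. u (n+1) (X (n+1) s) - bdf2 dt X n s) = 0"
  shows "\<forall>n \<in> {1..N-1}.
      \<rho>f / (4 * dt) * bdf2_bracket \<Omega> (u (n+1)) (u n) (u (n-1))
      + a_form \<Omega> (\<nu> (n+1)) (u (n+1)) (u (n+1))
      + (\<rho>s - \<rho>f) / (4 * dt) * bdf2_bracket B (X' (n+1)) (X' n) (X' (n-1))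
      + \<kappa> / (4 * dt) * bdf2_bracket B (F (n+1)) (F n) (F (n-1)) \<le> 0"
proof
  fix n assume n: "n \<in> {1..N-1}"
  have D: "open \<Omega>" "bounded \<Omega>" "open B" "bounded B"
    using fluid_domain(1) solid_domain by (auto simp: bounded_domain_def)
  have dt: "dt \<noteq> 0"
    using time by simp
  \<comment> \<open>Pressure, multiplier and composition are available only from level 2 on, the
    first step being given; the range of \<open>n\<close> puts \<open>n + 1\<close> there.\<close>
  have le: "n + 1 \<le> N" "n \<le> N" "n - 1 \<le> N" and n1: "n + 1 \<in> {2..N}"
    using n by auto
  have Sh_H1: "Sh \<subseteq> H1 B"
    by (auto simp: solid_space(2) P1_space_def)
  have u: "u m \<in> L2 \<Omega>" if "m \<le> N" for m
    using fluid_spaces(2) spaces(1)[OF that] by (auto simp: H1_0_def H1_def)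
  have X: "X m \<in> H1 B" "X' m \<in> L2 B" "F m \<in> L2 B" if "m \<le> N" for m
    using Sh_H1 spaces(2,3)[OF that] grad_H1(1)[of "X m" B] by (auto simp: F intro: H1_imp_L2)
  define Z where "Z = bdf2 dt X n"
  have Z: "Z \<in> Sh" and X'Sh: "bdf2 dt X' n \<in> Sh"
    unfolding Z_def solid_space(2)
    by (intro P1_space_bdf2 D spaces(2,3)[unfolded solid_space(2)] le)+

  have "c (lam (n+1)) (\<lambda>s. u (n+1) (X (n+1) s)) = c (lam (n+1)) Z"
  proof -
    define W where "W = (\<lambda>s. u (n+1) (X (n+1) s))"
    have W: "W \<in> H1 B" and ZH: "Z \<in> H1 B"
      using composition(2)[OF n1 spaces(1)[OF le(1)]] Z Sh_H1 by (auto simp: W_def)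
    \<comment> \<open>\<open>eq5\<close> annihilates the difference \<open>W - Z\<close>, whereas
      \<open>W\<close> and \<open>Z\<close> occur separately in \<open>eq1\<close> and
      \<open>eq4\<close>. Splitting \<open>W = (W - Z) + Z\<close> uses additivity of
      \<open>c\<close>, which is granted only on \<open>H1 B\<close>.\<close>
    have WZ: "(\<lambda>s. W s - Z s) \<in> H1 B"
      using H1_lincomb[OF D(3,4) W ZH, of 1 "-1"] by simp
    have lam: "lam (n+1) \<in> \<Lambda>"
      using spaces(5)[OF n1] multipliers(2,3) by (auto simp: multiplier_embedding_def)
    have "\<forall>\<mu>\<in>\<Lambda>. \<forall>z\<in>H1 B. \<forall>z'\<in>H1 B. c \<mu> (\<lambda>s. z s + z' s) = c \<mu> z + c \<mu> z'"
      using multipliers(1) unfolding coupling_form_def by (elim conjE)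
    from this[THEN bspec, OF lam, THEN bspec, OF WZ, THEN bspec, OF ZH]
    have "c (lam (n+1)) (\<lambda>s. (W s - Z s) + Z s) = c (lam (n+1)) (\<lambda>s. W s - Z s) + c (lam (n+1)) Z" .
    moreover have "c (lam (n+1)) (\<lambda>s. W s - Z s) = 0"
      using eq5[OF n spaces(5)[OF n1]] by (simp add: W_def Z_def)
    ultimately show ?thesis by (simp add: W_def)
  qed
  moreover have "c (lam (n+1)) Z = (\<rho>s - \<rho>f) * l2_inner B (bdf2 dt X' n) (X' (n+1))
      + \<kappa> * l2_inner B (bdf2 dt F n) (F (n+1))"
  proof -
    \<comment> \<open>\<open>eq3\<close> with \<open>w = bdf2 dt X' n\<close> trades
      \<open>Z\<close> for \<open>X' (n+1)\<close>, so that the inertial term takes the form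
      required by \<open>bdf2_bracket_eq\<close>.\<close>
    have "l2_inner B (bdf2 dt X' n) Z = l2_inner B (bdf2 dt X' n) (X' (n+1))"
      using eq3[OF n X'Sh] by (simp add: Z_def l2_inner_commute)
    moreover have "l2_inner B (F (n+1)) (grad B Z) = l2_inner B (bdf2 dt F n) (F (n+1))"
    proof -
      have FF: "F = (\<lambda>n. grad B (X n))"
        using F by auto
      have ZH: "Z \<in> H1 B"
        using Z Sh_H1 by blast
      have FZ: "bdf2 dt F n \<in> L2 B"
        by (intro L2_bdf2 X le)
      \<comment> \<open>Equality almost everywhere is enough under the integral; the integrability
        facts supply the measurability needed to exchange the integrands.\<close>
      have "AE x in lebesgue_on B. grad B Z x = bdf2 dt F n x"
        unfolding Z_def FF by (intro grad_bdf2 D X le)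
      then have "l2_inner B (grad B Z) (F (n+1)) = l2_inner B (bdf2 dt F n) (F (n+1))"
        unfolding l2_inner_def
        using X(3)[OF le(1)] grad_H1(1)[OF ZH] FZ L2_integrable_inner
        by (intro integral_cong_AE) (auto intro: borel_measurable_integrable)
      then show ?thesis by (simp add: l2_inner_commute)
    qed
    ultimately show ?thesis
      using eq4[OF n Z] by (simp add: linear_solid(2) l2_inner_scaleR_left)
  qed
  \<comment> \<open>In \<open>eq1\<close> with \<open>v = u (n+1)\<close>, the convective form is
    skew in its last two arguments and vanishes, \<open>eq2\<close> with \<open>q = p (n+1)\<close>
    removes the pressure, and the coupling term is replaced by the two solid products.\<close>
  ultimately have "\<rho>f * l2_inner \<Omega> (bdf2 dt u n) (u (n+1)) + a_form \<Omega> (\<nu> (n+1)) (u (n+1)) (u (n+1))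
      + (\<rho>s - \<rho>f) * l2_inner B (bdf2 dt X' n) (X' (n+1))
      + \<kappa> * l2_inner B (bdf2 dt F n) (F (n+1)) = 0"
    using eq1[OF n spaces(1)[OF le(1)]] eq2[OF n spaces(4)[OF n1]] by (simp add: b_form_def)
  moreover have
    "\<rho>f / (4 * dt) * bdf2_bracket \<Omega> (u (n+1)) (u n) (u (n-1)) = \<rho>f * l2_inner \<Omega> (bdf2 dt u n) (u (n+1))"
    "(\<rho>s - \<rho>f) / (4 * dt) * bdf2_bracket B (X' (n+1)) (X' n) (X' (n-1))
      = (\<rho>s - \<rho>f) * l2_inner B (bdf2 dt X' n) (X' (n+1))"
    "\<kappa> / (4 * dt) * bdf2_bracket B (F (n+1)) (F n) (F (n-1)) = \<kappa> * l2_inner B (bdf2 dt F n) (F (n+1))"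
    using bdf2_bracket_eq[of u n \<Omega> dt, OF u[OF le(1)] u[OF le(2)] u[OF le(3)] dt]
      bdf2_bracket_eq[of X' n B dt, OF X(2)[OF le(1)] X(2)[OF le(2)] X(2)[OF le(3)] dt]
      bdf2_bracket_eq[of F n B dt, OF X(3)[OF le(1)] X(3)[OF le(2)] X(3)[OF le(3)] dt]
    by (simp_all flip: times_divide_eq_right)
  ultimately show "\<rho>f / (4 * dt) * bdf2_bracket \<Omega> (u (n+1)) (u n) (u (n-1))
      + a_form \<Omega> (\<nu> (n+1)) (u (n+1)) (u (n+1))
      + (\<rho>s - \<rho>f) / (4 * dt) * bdf2_bracket B (X' (n+1)) (X' n) (X' (n-1))
      + \<kappa> / (4 * dt) * bdf2_bracket B (F (n+1)) (F n) (F (n-1)) \<le> 0"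
    by linarith
qed

end
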